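(* Let $\mathcal{D}$ be one of the step sets $\{(0,1),(1,1),(-1,0),(0,-1)\}$, $\{(0,1),(1,1),(-1,0),(-1,-1),(0,-1)\}$, $\{(0,1),(1,1),(-1,0),(1,0),(-1,-1)\}$, and let $0<t<1/|\mathcal{D}|$ be transcendental over $\mathbb{Q}$ and such that $G_t$ is infinite. Then for $i=1$ (and for $i=2$) there exist an integer $n\ge0$, $c_0,\dots,c_{n-1}\in\mathbb{C}$ and $g\in\mathbb{C}(\overline{E_t})$ such that $\delta^n(b_i)+c_{n-1}\delta^{n-1}(b_i)+\cdots+c_1\delta(b_i)+c_0b_i=\tau(g)-g$.
   Context: Let $d_{i,j}=1$ if $(i,j)\in\mathcal{D}$, else $0$. $\overline{E_t}\subset\mathbb{P}^1(\mathbb{C})\times\mathbb{P}^1(\mathbb{C})$ is the curve $x_0x_1y_0y_1-t\sum_{i,j=0}^2d_{i-1,j-1}x_0^ix_1^{2-i}y_0^jy_1^{2-j}=0$ (an elliptic curve here), with function field $\mathbb{C}(\overline{E_t})$ and coordinate functions $x=x_0/x_1$, $y=y_0/y_1$. $\iota_1,\iota_2$ are the involutions of $\overline{E_t}$ exchanging the two points of each fibre of the first, resp. second, projection; $\tau=\iota_2\circ\iota_1$; $G_t=\langle\iota_1,\iota_2\rangle$. For $f\in\mathbb{C}(\overline{E_t})$ and an automorphism $\sigma$, $\sigma(f)=f\circ\sigma$. Set $b_1=\iota_1(y)(\tau(x)-x)$ and $b_2=x(\iota_1(y)-y)$. Fix a nonzero regular differential $\Omega$ on $\overline{E_t}$ and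 let $\delta$ be the derivation with $df=\delta(f)\Omega$. *)

theory Defs
  imports Complex_Main "HOL-Computational_Algebra.Polynomial"
    "HOL-Algebra.QuotRing" "HOL-Algebra.Bij" "HOL-Algebra.Generated_Groups"
begin

section \<open>Curves in a product of two projective lines\<close>

definition proj_rel :: "complex \<times> complex \<Rightarrow> complex \<times> complex \<Rightarrow> bool" where
  "proj_rel a b \<longleftrightarrow> a \<noteq> (0, 0) \<and> b \<noteq> (0, 0) \<and>
     (\<exists>c. c \<noteq> 0 \<and> fst b = c * fst a \<and> snd b = c * snd a)"

lemma part_equivp_proj_rel: "part_equivp proj_rel"
proof (rule part_equivpI)
  show "\<exists>a. proj_rel a a"
    by (rule exI[of _ "(1, 1)"]) (auto simp: proj_rel_def)
  show "symp proj_rel"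
  proof (rule sympI)
    fix a b assume "proj_rel a b"
    then obtain c where "a \<noteq> (0, 0)" "b \<noteq> (0, 0)" "c \<noteq> 0" "fst b = c * fst a" "snd b = c * snd a"
      by (auto simp: proj_rel_def)
    then show "proj_rel b a"
      unfolding proj_rel_def by (intro conjI exI[of _ "inverse c"]) (simp_all add: field_simps)
  qed
  show "transp proj_rel"
  proof (rule transpI)
    fix a b d assume "proj_rel a b" "proj_rel b d"
    then obtain c c' where "a \<noteq> (0, 0)" "d \<noteq> (0, 0)" "c \<noteq> 0" "c' \<noteq> 0"
        "fst b = c * fst a" "snd b = c * snd a" "fst d = c' * fst b" "snd d = c' * snd b"
      by (auto simp: proj_rel_def)
    then show "proj_rel a d"
      unfolding proj_rel_def by (intro conjI exI[of _ "c' * c"]) simp_all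
  qed
qed

quotient_type p1 = "complex \<times> complex" / partial: proj_rel
  by (rule part_equivp_proj_rel)

type_synonym pt = "p1 \<times> p1"

text \<open>
  \<^term>\<open>rep_p1 p\<close> is a chosen pair of homogeneous coordinates of \<^term>\<open>p\<close>. The coordinates are only
  used for the vanishing of bihomogeneous forms, and for quotients of two forms of the same
  bidegree; neither depends on the choice.
\<close>

definition biform :: "nat \<Rightarrow> nat \<Rightarrow> (nat \<Rightarrow> nat \<Rightarrow> complex) \<Rightarrow> pt \<Rightarrow> complex" where
  "biform m n a = (\<lambda>(p, q).
     let (x0, x1) = rep_p1 p; (y0, y1) = rep_p1 q
     in \<Sum>i\<le>m. \<Sum>j\<le>n. a i j * x0 ^ i * x1 ^ (m - i) * y0 ^ j * y1 ^ (n - j))"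

definition kernel_curve :: "(int \<times> int) set \<Rightarrow> complex \<Rightarrow> pt set" where
  "kernel_curve \<D> t = {(p, q).
     let (x0, x1) = rep_p1 p; (y0, y1) = rep_p1 q
     in x0 * x1 * y0 * y1
        - t * (\<Sum>i\<le>2. \<Sum>j\<le>2. of_bool ((int i - 1, int j - 1) \<in> \<D>)
                * x0 ^ i * x1 ^ (2 - i) * y0 ^ j * y1 ^ (2 - j)) = 0}"

section \<open>The function field of an irreducible curve\<close>

text \<open>
  A rational function on a curve \<^term>\<open>E\<close> is a quotient of two bihomogeneous forms of the same bidegree
  whose denominator does not vanish identically on \<^term>\<open>E\<close>, i.e. (\<^term>\<open>E\<close> being irreducible) has only
  finitely many zeros on \<^term>\<open>E\<close>. It is determined by its values at all but finitely many points, so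
  we take all functions that agree with such a quotient outside a finite subset of \<^term>\<open>E\<close>, and
  divide by the ideal of those that vanish outside a finite subset of \<^term>\<open>E\<close>. In particular
  the values of a representative at the poles, or off \<^term>\<open>E\<close>, are irrelevant.
\<close>

definition represents :: "pt set \<Rightarrow> nat \<Rightarrow> nat \<Rightarrow> (nat \<Rightarrow> nat \<Rightarrow> complex) \<Rightarrow> (nat \<Rightarrow> nat \<Rightarrow> complex)
    \<Rightarrow> (pt \<Rightarrow> complex) \<Rightarrow> bool" where
  "represents E m n a b f \<longleftrightarrow>
     finite {z \<in> E. biform m n b z = 0} \<and> finite {z \<in> E. f z \<noteq> biform m n a z / biform m n b z}"

definition rat_ring :: "pt set \<Rightarrow> (pt \<Rightarrow> complex) ring" where
  "rat_ring E = \<lparr>carrier = {f. \<exists>m n a b. represents E m n a b f},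
     mult = (\<lambda>f g z. f z * g z), one = (\<lambda>z. 1), zero = (\<lambda>z. 0), add = (\<lambda>f g z. f z + g z)\<rparr>"

definition null_ideal :: "pt set \<Rightarrow> (pt \<Rightarrow> complex) set" where
  "null_ideal E = {f. finite {z \<in> E. f z \<noteq> 0}}"

definition function_field :: "pt set \<Rightarrow> (pt \<Rightarrow> complex) set ring" where
  "function_field E = rat_ring E Quot null_ideal E"

definition rat_class :: "pt set \<Rightarrow> (pt \<Rightarrow> complex) \<Rightarrow> (pt \<Rightarrow> complex) set" where
  "rat_class E f = null_ideal E +>\<^bsub>rat_ring E\<^esub> f"

definition const_fun :: "pt set \<Rightarrow> complex \<Rightarrow> (pt \<Rightarrow> complex) set" where
  "const_fun E c = rat_class E (\<lambda>z. c)"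

definition coord_x :: "pt set \<Rightarrow> (pt \<Rightarrow> complex) set" where
  "coord_x E = rat_class E (\<lambda>(p, q). fst (rep_p1 p) / snd (rep_p1 p))"

definition coord_y :: "pt set \<Rightarrow> (pt \<Rightarrow> complex) set" where
  "coord_y E = rat_class E (\<lambda>(p, q). fst (rep_p1 q) / snd (rep_p1 q))"

text \<open>The action \<open>f \<mapsto> f \<circ> \<sigma>\<close> of an automorphism \<open>\<sigma>\<close> of \<^term>\<open>E\<close>.\<close>

definition pullback :: "pt set \<Rightarrow> (pt \<Rightarrow> pt) \<Rightarrow> (pt \<Rightarrow> complex) set \<Rightarrow> (pt \<Rightarrow> complex) set" where
  "pullback E \<sigma> F = (\<Union>f\<in>F. rat_class E (f \<circ> \<sigma>))"

definition regular_at :: "pt set \<Rightarrow> pt \<Rightarrow> (pt \<Rightarrow> complex) set \<Rightarrow> bool" where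
  "regular_at E z F \<longleftrightarrow>
     (\<exists>m n a b f. represents E m n a b f \<and> biform m n b z \<noteq> 0 \<and> F = rat_class E f)"

section \<open>Derivations and differentials\<close>

definition derivations :: "pt set \<Rightarrow> ((pt \<Rightarrow> complex) set \<Rightarrow> (pt \<Rightarrow> complex) set) set" where
  "derivations E = (let K = function_field E in
     {D \<in> carrier K \<rightarrow>\<^sub>E carrier K.
        (\<forall>f\<in>carrier K. \<forall>g\<in>carrier K. D (f \<oplus>\<^bsub>K\<^esub> g) = D f \<oplus>\<^bsub>K\<^esub> D g) \<and>
        (\<forall>f\<in>carrier K. \<forall>g\<in>carrier K.
           D (f \<otimes>\<^bsub>K\<^esub> g) = (D f \<otimes>\<^bsub>K\<^esub> g) \<oplus>\<^bsub>K\<^esub> (f \<otimes>\<^bsub>K\<^esub> D g)) \<and>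
        (\<forall>c. D (const_fun E c) = \<zero>\<^bsub>K\<^esub>)})"

text \<open>
  The function field \<open>K\<close> is a finitely generated extension of the complex numbers, so its module
  of Kaehler differentials is finite-dimensional over \<open>K\<close> and hence is the \<open>K\<close>-dual of the
  \<open>K\<close>-space of derivations, with \<open>df\<close> the evaluation \<open>D \<mapsto> D f\<close>. Rational differentials
  are rendered in this way.
\<close>

type_synonym differential = "((pt \<Rightarrow> complex) set \<Rightarrow> (pt \<Rightarrow> complex) set) \<Rightarrow> (pt \<Rightarrow> complex) set"

definition differentials :: "pt set \<Rightarrow> differential set" where
  "differentials E = (let K = function_field E in
     {\<omega> \<in> derivations E \<rightarrow>\<^sub>E carrier K.
        (\<forall>D\<^sub>1\<in>derivations E. \<forall>D\<^sub>2\<in>derivations E.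
           \<omega> (\<lambda>f\<in>carrier K. D\<^sub>1 f \<oplus>\<^bsub>K\<^esub> D\<^sub>2 f) = \<omega> D\<^sub>1 \<oplus>\<^bsub>K\<^esub> \<omega> D\<^sub>2) \<and>
        (\<forall>h\<in>carrier K. \<forall>D\<in>derivations E.
           \<omega> (\<lambda>f\<in>carrier K. h \<otimes>\<^bsub>K\<^esub> D f) = h \<otimes>\<^bsub>K\<^esub> \<omega> D)})"

definition zero_diff :: "pt set \<Rightarrow> differential" where
  "zero_diff E = (\<lambda>D\<in>derivations E. \<zero>\<^bsub>function_field E\<^esub>)"

definition add_diff :: "pt set \<Rightarrow> differential \<Rightarrow> differential \<Rightarrow> differential" where
  "add_diff E \<omega> \<eta> = (\<lambda>D\<in>derivations E. \<omega> D \<oplus>\<^bsub>function_field E\<^esub> \<eta> D)"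

definition smult_diff :: "pt set \<Rightarrow> (pt \<Rightarrow> complex) set \<Rightarrow> differential \<Rightarrow> differential" where
  "smult_diff E h \<omega> = (\<lambda>D\<in>derivations E. h \<otimes>\<^bsub>function_field E\<^esub> \<omega> D)"

definition exterior_d :: "pt set \<Rightarrow> (pt \<Rightarrow> complex) set \<Rightarrow> differential" where
  "exterior_d E f = (\<lambda>D\<in>derivations E. D f)"

text \<open>
  A differential is regular at a point if it is a finite sum of terms \<open>f dg\<close> with \<open>f\<close> and \<open>g\<close>
  regular at that point.
\<close>

definition regular_differentials :: "pt set \<Rightarrow> differential set" where
  "regular_differentials E = {\<omega> \<in> differentials E. \<forall>z\<in>E. \<exists>fgs.
     (\<forall>(f, g)\<in>set fgs. regular_at E z f \<and> regular_at E z g) \<and>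
     \<omega> = foldr (\<lambda>(f, g) \<eta>. add_diff E (smult_diff E f (exterior_d E g)) \<eta>) fgs (zero_diff E)}"

section \<open>The group of the walk\<close>

text \<open>
  The fibre of the first projection through \<open>(p, q)\<close> is \<open>{(p, q), (p, q')}\<close>; at a ramification
  point it is a singleton, so that \<open>q' = q\<close> and the involution fixes the point. Likewise for the
  second projection.
\<close>

definition iota1 :: "pt set \<Rightarrow> pt \<Rightarrow> pt" where
  "iota1 E = (\<lambda>z\<in>E. (fst z, THE q'. {q. (fst z, q) \<in> E} = {snd z, q'}))"

definition iota2 :: "pt set \<Rightarrow> pt \<Rightarrow> pt" where
  "iota2 E = (\<lambda>z\<in>E. (THE p'. {p. (p, snd z) \<in> E} = {fst z, p'}, snd z))"

definition tau :: "pt set \<Rightarrow> pt \<Rightarrow> pt" where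
  "tau E = compose E (iota2 E) (iota1 E)"

definition walk_group :: "pt set \<Rightarrow> (pt \<Rightarrow> pt) set" where
  "walk_group E = generate (BijGroup E) {iota1 E, iota2 E}"

definition b1 :: "pt set \<Rightarrow> (pt \<Rightarrow> complex) set" where
  "b1 E = pullback E (iota1 E) (coord_y E) \<otimes>\<^bsub>function_field E\<^esub>
     (pullback E (tau E) (coord_x E) \<ominus>\<^bsub>function_field E\<^esub> coord_x E)"

definition b2 :: "pt set \<Rightarrow> (pt \<Rightarrow> complex) set" where
  "b2 E = coord_x E \<otimes>\<^bsub>function_field E\<^esub>
     (pullback E (iota1 E) (coord_y E) \<ominus>\<^bsub>function_field E\<^esub> coord_y E)"

end

theory Submission
  imports Defs
begin

text \<open>
  On each of the three curves the function \<open>x y\<close> decouples: \<open>x y = F(x) + G(y) + const\<close> with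
  rational \<open>F\<close> and \<open>G\<close>. Since \<open>F(x)\<close> is invariant under \<open>\<iota>\<^sub>1\<close> and \<open>G(y)\<close> under \<open>\<iota>\<^sub>2\<close>, it follows
  that \<open>b\<^sub>2 = \<iota>\<^sub>1(x y) - x y = \<iota>\<^sub>1(G(y)) - G(y) = \<tau>(G(y)) - G(y)\<close> and
  \<open>b\<^sub>1 = \<tau>(x y) - \<iota>\<^sub>1(x y) = (\<tau>(x y) - x y) - b\<^sub>2 = \<tau>(F(x)) - F(x)\<close>, so that \<open>n = 0\<close> works.
\<close>

section \<open>Binary forms on the projective line\<close>

text \<open>A quotient of degree 0 does not depend on the chosen representative. At infinity it
  takes the default value 0 of division by zero, so that point has to be excluded separately by
  \<open>snd (rep_p1 p) \<noteq> 0\<close>.\<close>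

definition affine_coord :: "p1 \<Rightarrow> complex" where
  "affine_coord p = fst (rep_p1 p) / snd (rep_p1 p)"

lemma rep_p1_eq_iff: "proj_rel (rep_p1 p) (rep_p1 q) \<longleftrightarrow> p = q"
  using Quotient3_rel_rep[OF Quotient3_p1] .

lemma rep_p1_nonzero: "rep_p1 p \<noteq> (0, 0)"
  using rep_p1_eq_iff[of p p] by (simp add: proj_rel_def)

lemma rep_abs_p1:
  assumes "a \<noteq> (0, 0)"
  obtains c where "c \<noteq> 0" "rep_p1 (abs_p1 a) = (c * fst a, c * snd a)"
proof -
  have "proj_rel a a"
    using assms unfolding proj_rel_def by (intro conjI exI[of _ 1]) auto
  then have "proj_rel (rep_p1 (abs_p1 a)) a"
    using rep_abs_rsp_left[OF Quotient3_p1] by blast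
  then obtain c where c: "c \<noteq> 0" "fst a = c * fst (rep_p1 (abs_p1 a))"
      "snd a = c * snd (rep_p1 (abs_p1 a))"
    by (auto simp: proj_rel_def)
  show ?thesis
    by (rule that[of "inverse c"]) (use c in \<open>simp_all add: prod_eq_iff\<close>)
qed

text \<open>A vanishing determinant makes the two nonzero coordinate vectors proportional; the case
  split finds a coordinate from which the scalar can be read off.\<close>

lemma p1_eqI:
  assumes "fst (rep_p1 p) * snd (rep_p1 q) = fst (rep_p1 q) * snd (rep_p1 p)"
  shows "p = q"
proof -
  obtain a b where p: "rep_p1 p = (a, b)" by fastforce
  obtain c d where q: "rep_p1 q = (c, d)" by fastforce
  have nz: "(a, b) \<noteq> (0, 0)" "(c, d) \<noteq> (0, 0)"
    using rep_p1_nonzero[of p] rep_p1_nonzero[of q] p q by auto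
  have eq: "a * d = c * b"
    using assms p q by simp
  have "\<exists>k. k \<noteq> 0 \<and> c = k * a \<and> d = k * b"
  proof (cases "a = 0")
    case True
    with nz eq have "b \<noteq> 0" "c = 0" "d \<noteq> 0" by auto
    with True show ?thesis by (intro exI[of _ "d / b"]) simp
  next
    case False
    with nz eq have "c \<noteq> 0" by auto
    with False eq show ?thesis by (intro exI[of _ "c / a"]) (simp add: field_simps)
  qed
  then show ?thesis
    using nz by (simp add: p q proj_rel_def flip: rep_p1_eq_iff)
qed

lemma linear_form_root:
  assumes "a \<noteq> 0 \<or> b \<noteq> 0"
  shows "\<exists>r. {p. a * fst (rep_p1 p) + b * snd (rep_p1 p) = 0} = {r}"
proof -
  have nz: "(b, - a) \<noteq> (0, 0)" using assms by auto
  obtain c where c: "c \<noteq> 0" "rep_p1 (abs_p1 (b, - a)) = (c * b, - (c * a))"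
    using rep_abs_p1[OF nz] by (metis fst_conv mult_minus_right snd_conv)
  have "p = abs_p1 (b, - a)" if "a * fst (rep_p1 p) + b * snd (rep_p1 p) = 0" for p
  proof (rule p1_eqI)
    have eq: "a * fst (rep_p1 p) = - (b * snd (rep_p1 p))"
      using that by (rule eq_neg_iff_add_eq_0[THEN iffD2])
    have "fst (rep_p1 p) * snd (rep_p1 (abs_p1 (b, - a))) = - c * (a * fst (rep_p1 p))"
      by (simp add: c(2))
    also have "\<dots> = fst (rep_p1 (abs_p1 (b, - a))) * snd (rep_p1 p)"
      unfolding eq by (simp add: c(2))
    finally show "fst (rep_p1 p) * snd (rep_p1 (abs_p1 (b, - a)))
        = fst (rep_p1 (abs_p1 (b, - a))) * snd (rep_p1 p)" .
  qed
  moreover have "a * fst (rep_p1 (abs_p1 (b, - a))) + b * snd (rep_p1 (abs_p1 (b, - a))) = 0"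
    by (simp add: c)
  ultimately show ?thesis
    by (intro exI[of _ "abs_p1 (b, - a)"]) blast
qed

text \<open>For \<open>a = 0\<close> the factor \<open>v\<close> splits off; otherwise the quadratic
  formula applies, \<open>s\<close> being a square root of the discriminant. That neither factor is
  the zero form is what bounds the number of roots later.\<close>

lemma binary_quadratic_factors:
  fixes a b c :: complex
  assumes "a \<noteq> 0 \<or> b \<noteq> 0 \<or> c \<noteq> 0"
  obtains k l m n where "k \<noteq> 0 \<or> l \<noteq> 0" "m \<noteq> 0 \<or> n \<noteq> 0"
    "\<And>u v. a * u\<^sup>2 + b * u * v + c * v\<^sup>2 = (k * u + l * v) * (m * u + n * v)"
proof (cases "a = 0")
  case True
  show ?thesis
    by (rule that[of 0 1 b c]) (use True assms in \<open>auto simp: algebra_simps power2_eq_square\<close>)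
next
  case False
  define s where "s = csqrt (b\<^sup>2 - 4 * a * c)"
  have s: "s\<^sup>2 = b\<^sup>2 - 4 * a * c" by (simp add: s_def)
  have "a * u\<^sup>2 + b * u * v + c * v\<^sup>2
      = (a * u + ((b + s) / 2) * v) * (1 * u + ((b - s) / (2 * a)) * v)" for u v
  proof -
    have "(a * u + ((b + s) / 2) * v) * (1 * u + ((b - s) / (2 * a)) * v)
        = a * u\<^sup>2 + b * u * v + (b\<^sup>2 - s\<^sup>2) / (4 * a) * v\<^sup>2"
      using False by (simp add: field_simps power2_eq_square)
    then show ?thesis using False by (simp add: s)
  qed
  with False show ?thesis by (intro that[of a "(b + s) / 2" 1 "(b - s) / (2 * a)"]) auto
qed

lemma quadratic_form_roots:
  fixes a b c :: complex
  assumes "a \<noteq> 0 \<or> b \<noteq> 0 \<or> c \<noteq> 0"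
  shows "\<exists>r s. {p. a * (fst (rep_p1 p))\<^sup>2 + b * fst (rep_p1 p) * snd (rep_p1 p)
      + c * (snd (rep_p1 p))\<^sup>2 = 0} = {r, s}"
proof -
  obtain k l m n where f: "k \<noteq> 0 \<or> l \<noteq> 0" "m \<noteq> 0 \<or> n \<noteq> 0"
    "\<And>u v. a * u\<^sup>2 + b * u * v + c * v\<^sup>2 = (k * u + l * v) * (m * u + n * v)"
    using binary_quadratic_factors[OF assms] by blast
  obtain r where r: "{p. k * fst (rep_p1 p) + l * snd (rep_p1 p) = 0} = {r}"
    using linear_form_root[OF f(1)] ..
  obtain s where s: "{p. m * fst (rep_p1 p) + n * snd (rep_p1 p) = 0} = {s}"
    using linear_form_root[OF f(2)] ..
  have "{p. a * (fst (rep_p1 p))\<^sup>2 + b * fst (rep_p1 p) * snd (rep_p1 p)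
      + c * (snd (rep_p1 p))\<^sup>2 = 0} = {r} \<union> {s}"
    unfolding f(3) mult_eq_0_iff Collect_disj_eq r s ..
  then show ?thesis by auto
qed

lemma finite_infinity_p1: "finite {p. snd (rep_p1 p) = 0}"
  using linear_form_root[of 0 1] by auto

text \<open>Away from infinity the value \<open>s\<close> is taken only at the root of the linear
  form with coefficients \<open>1\<close> and \<open>- s\<close>.\<close>

lemma finite_affine_coord_vimage:
  assumes "finite S"
  shows "finite {p. snd (rep_p1 p) \<noteq> 0 \<and> affine_coord p \<in> S}"
proof (rule finite_subset)
  show "finite (\<Union>s\<in>S. {p. 1 * fst (rep_p1 p) + (- s) * snd (rep_p1 p) = 0})"
  proof (intro finite_UN_I assms)
    fix s show "finite {p. 1 * fst (rep_p1 p) + (- s) * snd (rep_p1 p) = 0}"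
      using linear_form_root[of 1 "- s"] by auto
  qed
qed (auto simp: affine_coord_def)

section \<open>Classes of rational functions\<close>

text \<open>This description is valid for arbitrary functions, rational or not. Sums and products of
  classes can thus be computed pointwise, with no prior proof that the quotient is a ring.\<close>

lemma rat_class_eq: "rat_class E f = {h. finite {z \<in> E. h z \<noteq> f z}}"
proof -
  have "h \<in> rat_class E f \<longleftrightarrow> h \<in> {h. finite {z \<in> E. h z \<noteq> f z}}" for h
  proof -
    have "h \<in> rat_class E f \<longleftrightarrow> (\<exists>k. finite {z \<in> E. k z \<noteq> 0} \<and> h = (\<lambda>z. k z + f z))"
      by (auto simp: rat_class_def a_r_coset_def' rat_ring_def null_ideal_def)
    also have "\<dots> \<longleftrightarrow> finite {z \<in> E. h z \<noteq> f z}"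
    proof
      assume "finite {z \<in> E. h z \<noteq> f z}"
      then show "\<exists>k. finite {z \<in> E. k z \<noteq> 0} \<and> h = (\<lambda>z. k z + f z)"
        by (intro exI[of _ "\<lambda>z. h z - f z"]) simp
    qed (elim exE conjE, simp)
    finally show ?thesis by simp
  qed
  then show ?thesis by blast
qed

lemma rat_class_eqI:
  assumes "finite {z \<in> E. f z \<noteq> g z}"
  shows "rat_class E f = rat_class E g"
proof -
  have "finite {z \<in> E. h z \<noteq> v z}"
    if "finite {z \<in> E. h z \<noteq> u z}" "finite {z \<in> E. u z \<noteq> v z}" for h u v :: "pt \<Rightarrow> complex"
    by (rule finite_subset[OF _ finite_UnI[OF that]]) auto
  from this[of _ f g] this[of _ g f] show ?thesis
    using assms unfolding rat_class_eq by (auto simp: eq_commute[of "f _"])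
qed

lemma rat_class_self: "f \<in> rat_class E f"
  by (simp add: rat_class_eq)

lemma function_field_add:
  "rat_class E f \<oplus>\<^bsub>function_field E\<^esub> rat_class E g = rat_class E (\<lambda>z. f z + g z)"
proof -
  have "rat_class E f \<oplus>\<^bsub>function_field E\<^esub> rat_class E g
      = {h. \<exists>u v. u \<in> rat_class E f \<and> v \<in> rat_class E g \<and> h = (\<lambda>z. u z + v z)}"
    by (auto simp: function_field_def FactRing_def set_add_def' rat_ring_def)
  also have "\<dots> = rat_class E (\<lambda>z. f z + g z)"
  proof (intro equalityI subsetI)
    fix h assume "h \<in> {h. \<exists>u v. u \<in> rat_class E f \<and> v \<in> rat_class E g \<and> h = (\<lambda>z. u z + v z)}"
    then obtain u v where "finite {z \<in> E. u z \<noteq> f z}" "finite {z \<in> E. v z \<noteq> g z}"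
        and h: "h = (\<lambda>z. u z + v z)"
      by (auto simp: rat_class_eq)
    then have "finite ({z \<in> E. u z \<noteq> f z} \<union> {z \<in> E. v z \<noteq> g z})" by simp
    then have "finite {z \<in> E. h z \<noteq> f z + g z}" by (rule rev_finite_subset) (auto simp: h)
    then show "h \<in> rat_class E (\<lambda>z. f z + g z)" by (simp add: rat_class_eq)
  next
    fix h assume "h \<in> rat_class E (\<lambda>z. f z + g z)"
    then have "finite {z \<in> E. h z \<noteq> f z + g z}" by (simp add: rat_class_eq)
    then have "finite {z \<in> E. h z - g z \<noteq> f z}"
      by (rule rev_finite_subset) (auto simp: algebra_simps)
    then have "(\<lambda>z. h z - g z) \<in> rat_class E f" by (simp add: rat_class_eq)
    moreover have "h = (\<lambda>z. (h z - g z) + g z)" by simp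
    ultimately show "h \<in> {h. \<exists>u v. u \<in> rat_class E f \<and> v \<in> rat_class E g \<and> h = (\<lambda>z. u z + v z)}"
      using rat_class_self[of g E] by blast
  qed
  finally show ?thesis .
qed

text \<open>The product of cosets is a union over all pairs of representatives. All members of this
  union are the same class, since changing the factors at finitely many points changes the product
  at finitely many points.\<close>

lemma function_field_mult:
  "rat_class E f \<otimes>\<^bsub>function_field E\<^esub> rat_class E g = rat_class E (\<lambda>z. f z * g z)"
proof -
  have "rat_class E f \<otimes>\<^bsub>function_field E\<^esub> rat_class E g
      = (\<Union>u\<in>rat_class E f. \<Union>v\<in>rat_class E g. rat_class E (\<lambda>z. u z * v z))"
    by (simp add: function_field_def FactRing_def rcoset_mult_def rat_class_def)
       (simp add: rat_ring_def)
  also have "\<dots> = (\<Union>u\<in>rat_class E f. \<Union>v\<in>rat_class E g. rat_class E (\<lambda>z. f z * g z))"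
  proof (intro SUP_cong refl rat_class_eqI)
    fix u v assume "u \<in> rat_class E f" "v \<in> rat_class E g"
    then have "finite ({z \<in> E. u z \<noteq> f z} \<union> {z \<in> E. v z \<noteq> g z})" by (simp add: rat_class_eq)
    then show "finite {z \<in> E. u z * v z \<noteq> f z * g z}" by (rule rev_finite_subset) auto
  qed
  also have "\<dots> = rat_class E (\<lambda>z. f z * g z)"
    using rat_class_self[of f E] rat_class_self[of g E] by blast
  finally show ?thesis .
qed

lemma function_field_zero: "\<zero>\<^bsub>function_field E\<^esub> = rat_class E (\<lambda>z. 0)"
  by (simp add: function_field_def FactRing_def rat_class_eq null_ideal_def)

lemma carrier_function_field:
  "carrier (function_field E) = rat_class E ` carrier (rat_ring E)"
  by (auto simp: function_field_def FactRing_def A_RCOSETS_def' rat_class_def)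

lemma uminus_carrier_rat_ring:
  assumes "f \<in> carrier (rat_ring E)"
  shows "(\<lambda>z. - f z) \<in> carrier (rat_ring E)"
proof -
  obtain m n a b where r: "represents E m n a b f"
    using assms by (auto simp: rat_ring_def)
  have "biform m n (\<lambda>i j. - a i j) z = - biform m n a z" for z
    by (simp add: biform_def split_def Let_def sum_negf)
  with r have "represents E m n (\<lambda>i j. - a i j) b (\<lambda>z. - f z)"
    by (simp add: represents_def)
  then show ?thesis by (auto simp: rat_ring_def)
qed

text \<open>The additive inverse is a definite description ranging over the carrier. The hypothesis
  on \<open>g\<close> puts the class of \<open>- g\<close> into the carrier, and uniqueness is
  checked directly on representatives.\<close>

lemma function_field_minus:
  assumes "g \<in> carrier (rat_ring E)"
  shows "rat_class E f \<ominus>\<^bsub>function_field E\<^esub> rat_class E g = rat_class E (\<lambda>z. f z - g z)"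
proof -
  have "\<ominus>\<^bsub>function_field E\<^esub> rat_class E g = rat_class E (\<lambda>z. - g z)"
    unfolding a_inv_def m_inv_def
  proof (rule the_equality, goal_cases)
    case 1
    show ?case
      using uminus_carrier_rat_ring[OF assms]
      by (auto simp: carrier_function_field function_field_add function_field_zero)
  next
    case (2 y)
    then obtain h where h: "y = rat_class E h" "rat_class E (\<lambda>z. g z + h z) = rat_class E (\<lambda>z. 0)"
      by (auto simp: carrier_function_field function_field_add function_field_zero)
    then have "(\<lambda>z. g z + h z) \<in> rat_class E (\<lambda>z. 0)"
      using rat_class_self by metis
    then have "finite {z \<in> E. g z + h z \<noteq> 0}" by (simp add: rat_class_eq)
    then have "finite {z \<in> E. h z \<noteq> - g z}"
      by (rule rev_finite_subset) (auto simp: add_eq_0_iff)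
    then show ?case unfolding h(1) by (rule rat_class_eqI)
  qed
  then show ?thesis by (simp add: a_minus_def function_field_add)
qed

section \<open>Curves with finite fibres over both factors\<close>

text \<open>A fibre with one point is the case \<open>q\<^sub>1 = q\<^sub>2\<close>.\<close>

locale two_fibre_curve =
  fixes E :: "pt set"
  assumes fibre1: "\<exists>q\<^sub>1 q\<^sub>2. {q. (p, q) \<in> E} = {q\<^sub>1, q\<^sub>2}"
    and fibre2: "\<exists>p\<^sub>1 p\<^sub>2. {p. (p, q) \<in> E} = {p\<^sub>1, p\<^sub>2}"
begin

text \<open>The description in \<open>iota1\<close> is well defined: a set of the form
  \<open>{snd z, q'}\<close> with \<open>snd z\<close> fixed determines \<open>q'\<close>, also when
  the two entries coincide.\<close>

lemma iota1:
  assumes "z \<in> E"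
  shows "iota1 E z \<in> E" "fst (iota1 E z) = fst z"
proof -
  obtain q\<^sub>1 q\<^sub>2 where *: "{q. (fst z, q) \<in> E} = {q\<^sub>1, q\<^sub>2}" using fibre1 by blast
  moreover from assms have "snd z \<in> {q. (fst z, q) \<in> E}" by simp
  ultimately have "snd z = q\<^sub>1 \<or> snd z = q\<^sub>2" by blast
  with * have "\<exists>q'. {q. (fst z, q) \<in> E} = {snd z, q'}" by (metis insert_commute)
  then have "\<exists>!q'. {q. (fst z, q) \<in> E} = {snd z, q'}" by (auto simp: doubleton_eq_iff)
  then have "{q. (fst z, q) \<in> E} = {snd z, THE q'. {q. (fst z, q) \<in> E} = {snd z, q'}}"
    by (rule theI')
  then show "iota1 E z \<in> E" "fst (iota1 E z) = fst z"
    using assms by (auto simp: iota1_def)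
qed

lemma iota2:
  assumes "z \<in> E"
  shows "iota2 E z \<in> E" "snd (iota2 E z) = snd z"
proof -
  obtain p\<^sub>1 p\<^sub>2 where *: "{p. (p, snd z) \<in> E} = {p\<^sub>1, p\<^sub>2}" using fibre2 by blast
  moreover from assms have "fst z \<in> {p. (p, snd z) \<in> E}" by simp
  ultimately have "fst z = p\<^sub>1 \<or> fst z = p\<^sub>2" by blast
  with * have "\<exists>p'. {p. (p, snd z) \<in> E} = {fst z, p'}" by (metis insert_commute)
  then have "\<exists>!p'. {p. (p, snd z) \<in> E} = {fst z, p'}" by (auto simp: doubleton_eq_iff)
  then have "{p. (p, snd z) \<in> E} = {fst z, THE p'. {p. (p, snd z) \<in> E} = {fst z, p'}}"
    by (rule theI')
  then show "iota2 E z \<in> E" "snd (iota2 E z) = snd z"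
    using assms by (auto simp: iota2_def)
qed

text \<open>The last equation is what makes every function of \<open>y\<close> take the same value
  at \<open>tau E z\<close> and \<open>iota1 E z\<close>.\<close>

lemma tau:
  assumes "z \<in> E"
  shows "tau E z \<in> E" "tau E z = iota2 E (iota1 E z)" "snd (tau E z) = snd (iota1 E z)"
  using assms iota1[OF assms] iota2[of "iota1 E z"] by (simp_all add: tau_def compose_def)

lemma finite_fst_vimage:
  assumes "finite S"
  shows "finite {z \<in> E. fst z \<in> S}"
proof (rule finite_subset)
  show "{z \<in> E. fst z \<in> S} \<subseteq> (SIGMA p:S. {q. (p, q) \<in> E})" by auto
  have "finite {q. (p, q) \<in> E}" for p
    using fibre1[of p] by (metis finite.emptyI finite_insert)
  with assms show "finite (SIGMA p:S. {q. (p, q) \<in> E})" by blast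
qed

lemma finite_snd_vimage:
  assumes "finite S"
  shows "finite {z \<in> E. snd z \<in> S}"
proof (rule finite_subset)
  show "{z \<in> E. snd z \<in> S} \<subseteq> (\<Union>q\<in>S. (\<lambda>p. (p, q)) ` {p. (p, q) \<in> E})" by force
  have "finite {p. (p, q) \<in> E}" for q
    using fibre2[of q] by (metis finite.emptyI finite_insert)
  with assms show "finite (\<Union>q\<in>S. (\<lambda>p. (p, q)) ` {p. (p, q) \<in> E})" by blast
qed

lemma finite_iota1_vimage:
  assumes "finite S"
  shows "finite {z \<in> E. iota1 E z \<in> S}"
  by (rule finite_subset[OF _ finite_fst_vimage[of "fst ` S"]]) (use assms iota1 in force)+

lemma finite_tau_vimage:
  assumes "finite S"
  shows "finite {z \<in> E. tau E z \<in> S}"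
proof -
  have "finite {w \<in> E. iota2 E w \<in> S}"
    by (rule finite_subset[OF _ finite_snd_vimage[of "snd ` S"]]) (use assms iota2 in force)+
  then have "finite {z \<in> E. iota1 E z \<in> {w \<in> E. iota2 E w \<in> S}}"
    by (rule finite_iota1_vimage)
  then show ?thesis by (rule rev_finite_subset) (use iota1 tau in auto)
qed

text \<open>Finiteness of preimages keeps two functions that agree off a finite set in agreement
  after composition, so any representative may be used.\<close>

lemma pullback_rat_class:
  assumes "\<And>z. z \<in> E \<Longrightarrow> \<sigma> z \<in> E"
    and "\<And>S. finite S \<Longrightarrow> finite {z \<in> E. \<sigma> z \<in> S}"
  shows "pullback E \<sigma> (rat_class E f) = rat_class E (f \<circ> \<sigma>)"
proof -
  have "pullback E \<sigma> (rat_class E f) = (\<Union>g\<in>rat_class E f. rat_class E (f \<circ> \<sigma>))"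
    unfolding pullback_def
  proof (intro SUP_cong refl rat_class_eqI)
    fix g assume "g \<in> rat_class E f"
    then have "finite {z \<in> E. \<sigma> z \<in> {w \<in> E. g w \<noteq> f w}}"
      by (intro assms(2)) (simp add: rat_class_eq)
    then show "finite {z \<in> E. (g \<circ> \<sigma>) z \<noteq> (f \<circ> \<sigma>) z}"
      by (rule rev_finite_subset) (use assms(1) in auto)
  qed
  then show ?thesis using rat_class_self[of f E] by blast
qed

lemma pullback_iota1: "pullback E (iota1 E) (rat_class E f) = rat_class E (f \<circ> iota1 E)"
  by (intro pullback_rat_class iota1(1) finite_iota1_vimage)

lemma pullback_tau: "pullback E (tau E) (rat_class E f) = rat_class E (f \<circ> tau E)"
  by (intro pullback_rat_class tau(1) finite_tau_vimage)

end

section \<open>Rational functions of a single coordinate\<close>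

lemma homogenization_eq:
  fixes P :: "complex poly"
  assumes "degree P \<le> m" "v \<noteq> 0"
  shows "(\<Sum>i\<le>m. coeff P i * u ^ i * v ^ (m - i)) = v ^ m * poly P (u / v)"
proof -
  have "poly P (u / v) = (\<Sum>i\<le>m. coeff P i * (u / v) ^ i)"
    unfolding poly_altdef
    by (rule sum.mono_neutral_left) (use assms(1) coeff_eq_0[of P] in auto)
  moreover have "coeff P i * u ^ i * v ^ (m - i) = v ^ m * (coeff P i * (u / v) ^ i)"
    if "i \<le> m" for i
    using assms(2) that by (simp add: power_divide power_diff)
  ultimately show ?thesis by (auto simp: sum_distrib_left intro!: sum.cong)
qed

definition rational_coord :: "complex poly \<Rightarrow> complex poly \<Rightarrow> p1 \<Rightarrow> complex" where
  "rational_coord P Q p = poly P (affine_coord p) / poly Q (affine_coord p)"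

text \<open>The excluded values 0 and -1, together with infinity, cover all poles of the functions
  \<open>F\<close> and \<open>G\<close> used for the three step sets.\<close>

definition generic :: "pt \<Rightarrow> bool" where
  "generic z \<longleftrightarrow> snd (rep_p1 (fst z)) \<noteq> 0 \<and> affine_coord (fst z) \<notin> {0, - 1} \<and>
     snd (rep_p1 (snd z)) \<noteq> 0 \<and> affine_coord (snd z) \<notin> {0, - 1}"

context two_fibre_curve
begin

lemma finite_not_generic: "finite {z \<in> E. \<not> generic z}"
proof -
  define S where "S = {p. snd (rep_p1 p) = 0} \<union> {p. snd (rep_p1 p) \<noteq> 0 \<and> affine_coord p \<in> {0, - 1}}"
  have "finite S"
    unfolding S_def by (intro finite_UnI finite_infinity_p1 finite_affine_coord_vimage) simp
  then have "finite ({z \<in> E. fst z \<in> S} \<union> {z \<in> E. snd z \<in> S})"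
    by (intro finite_UnI finite_fst_vimage finite_snd_vimage)
  then show ?thesis by (rule rev_finite_subset) (auto simp: generic_def S_def)
qed

text \<open>Homogenizing both polynomials to the common degree \<open>m\<close> gives forms of
  bidegree \<open>(m, 0)\<close>. Away from infinity the powers of the second coordinate cancel in
  their quotient.\<close>

lemma rational_coord_fst:
  assumes "Q \<noteq> 0"
  shows "(\<lambda>z. rational_coord P Q (fst z)) \<in> carrier (rat_ring E)"
proof -
  define m where "m = max (degree P) (degree Q)"
  define S where "S = {p. snd (rep_p1 p) = 0} \<union>
    {p. snd (rep_p1 p) \<noteq> 0 \<and> affine_coord p \<in> {x. poly Q x = 0}}"
  have hom: "biform m 0 (\<lambda>i j. coeff R i) z = snd (rep_p1 (fst z)) ^ m * poly R (affine_coord (fst z))"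
    if "degree R \<le> m" "snd (rep_p1 (fst z)) \<noteq> 0" for R z
    using homogenization_eq[OF that, of "fst (rep_p1 (fst z))"]
    by (simp add: biform_def split_def Let_def affine_coord_def)
  have deg: "degree P \<le> m" "degree Q \<le> m" by (simp_all add: m_def)
  have "finite {z \<in> E. fst z \<in> S}"
    unfolding S_def
    by (intro finite_fst_vimage finite_UnI finite_infinity_p1 finite_affine_coord_vimage
        poly_roots_finite assms)
  then have "represents E m 0 (\<lambda>i j. coeff P i) (\<lambda>i j. coeff Q i) (\<lambda>z. rational_coord P Q (fst z))"
    unfolding represents_def
    by (intro conjI; elim rev_finite_subset)
       (use hom deg in \<open>auto simp: S_def rational_coord_def simp del: split_paired_All\<close>)
  then show ?thesis by (auto simp: rat_ring_def)
qed

lemma rational_coord_snd: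
  assumes "Q \<noteq> 0"
  shows "(\<lambda>z. rational_coord P Q (snd z)) \<in> carrier (rat_ring E)"
proof -
  define m where "m = max (degree P) (degree Q)"
  define S where "S = {p. snd (rep_p1 p) = 0} \<union>
    {p. snd (rep_p1 p) \<noteq> 0 \<and> affine_coord p \<in> {x. poly Q x = 0}}"
  have hom: "biform 0 m (\<lambda>i j. coeff R j) z = snd (rep_p1 (snd z)) ^ m * poly R (affine_coord (snd z))"
    if "degree R \<le> m" "snd (rep_p1 (snd z)) \<noteq> 0" for R z
    using homogenization_eq[OF that, of "fst (rep_p1 (snd z))"]
    by (simp add: biform_def split_def Let_def affine_coord_def)
  have deg: "degree P \<le> m" "degree Q \<le> m" by (simp_all add: m_def)
  have "finite {z \<in> E. snd z \<in> S}"
    unfolding S_def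
    by (intro finite_snd_vimage finite_UnI finite_infinity_p1 finite_affine_coord_vimage
        poly_roots_finite assms)
  then have "represents E 0 m (\<lambda>i j. coeff P j) (\<lambda>i j. coeff Q j) (\<lambda>z. rational_coord P Q (snd z))"
    unfolding represents_def
    by (intro conjI; elim rev_finite_subset)
       (use hom deg in \<open>auto simp: S_def rational_coord_def simp del: split_paired_All\<close>)
  then show ?thesis by (auto simp: rat_ring_def)
qed

section \<open>Coordinate functions and decoupling on the curve\<close>

lemma coord_x: "coord_x E = rat_class E (\<lambda>z. affine_coord (fst z))"
  by (simp add: coord_x_def affine_coord_def split_def)

lemma coord_y: "coord_y E = rat_class E (\<lambda>z. affine_coord (snd z))"
  by (simp add: coord_y_def affine_coord_def split_def)

lemma affine_coord_carrier:
  "(\<lambda>z. affine_coord (fst z)) \<in> carrier (rat_ring E)"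
  "(\<lambda>z. affine_coord (snd z)) \<in> carrier (rat_ring E)"
  using rational_coord_fst[of 1 "[:0, 1:]"] rational_coord_snd[of 1 "[:0, 1:]"]
  by (simp_all add: rational_coord_def)

lemma b1_eq: "b1 E = rat_class E (\<lambda>z. affine_coord (snd (iota1 E z)) *
    (affine_coord (fst (tau E z)) - affine_coord (fst z)))"
  by (simp add: b1_def coord_x coord_y pullback_iota1 pullback_tau function_field_minus
      affine_coord_carrier function_field_mult)

lemma b2_eq: "b2 E = rat_class E (\<lambda>z. affine_coord (fst z) *
    (affine_coord (snd (iota1 E z)) - affine_coord (snd z)))"
  by (simp add: b2_def coord_x coord_y pullback_iota1 function_field_minus
      affine_coord_carrier function_field_mult)

text \<open>The decoupling is evaluated at \<open>z\<close>, \<open>iota1 E z\<close> and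
  \<open>tau E z\<close>. The first two points share \<open>x\<close> and the last two share
  \<open>y\<close>, so subtracting consecutive equations cancels \<open>k\<close> and leaves the
  coboundaries of \<open>G\<close> and \<open>F\<close> respectively.\<close>

lemma tau_coboundary_if_decoupled:
  assumes F: "(\<lambda>z. F (fst z)) \<in> carrier (rat_ring E)"
    and G: "(\<lambda>z. G (snd z)) \<in> carrier (rat_ring E)"
    and decoupled: "finite {z \<in> E. affine_coord (fst z) * affine_coord (snd z) \<noteq> F (fst z) + G (snd z) + k}"
    and b: "b \<in> {b1 E, b2 E}"
  shows "\<exists>g\<in>carrier (function_field E). b = pullback E (tau E) g \<ominus>\<^bsub>function_field E\<^esub> g"
proof -
  define N where "N = {z \<in> E. affine_coord (fst z) * affine_coord (snd z) \<noteq> F (fst z) + G (snd z) + k}"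
  \<comment> \<open>These are the points for which the decoupling fails at \<open>z\<close> or at
    one of its images; finite preimages keep this set finite.\<close>
  define S where "S = N \<union> {z \<in> E. iota1 E z \<in> N} \<union> {z \<in> E. tau E z \<in> N}"
  have S: "finite S"
    using decoupled unfolding S_def
    by (intro finite_UnI finite_iota1_vimage finite_tau_vimage) (simp_all add: N_def)
  have xy: "affine_coord (fst z) * affine_coord (snd z) = F (fst z) + G (snd z) + k"
      "affine_coord (fst z) * affine_coord (snd (iota1 E z)) = F (fst z) + G (snd (iota1 E z)) + k"
      "affine_coord (fst (tau E z)) * affine_coord (snd (iota1 E z))
        = F (fst (tau E z)) + G (snd (iota1 E z)) + k"
    if "z \<in> E" "z \<notin> S" for z
    using that iota1[OF that(1)] tau[OF that(1)] by (auto simp: S_def N_def)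
  have "b1 E = pullback E (tau E) (rat_class E (\<lambda>z. F (fst z)))
      \<ominus>\<^bsub>function_field E\<^esub> rat_class E (\<lambda>z. F (fst z))"
    unfolding b1_eq pullback_tau function_field_minus[OF F]
  proof (rule rat_class_eqI, rule finite_subset[OF _ S], rule subsetI, rule ccontr)
    fix z assume "z \<in> {z \<in> E. affine_coord (snd (iota1 E z)) *
        (affine_coord (fst (tau E z)) - affine_coord (fst z))
        \<noteq> ((\<lambda>z. F (fst z)) \<circ> tau E) z - F (fst z)}" "z \<notin> S"
    then show False using xy(2,3)[of z] by (simp add: algebra_simps)
  qed
  moreover have "b2 E = pullback E (tau E) (rat_class E (\<lambda>z. G (snd z)))
      \<ominus>\<^bsub>function_field E\<^esub> rat_class E (\<lambda>z. G (snd z))"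
    unfolding b2_eq pullback_tau function_field_minus[OF G]
  proof (rule rat_class_eqI, rule finite_subset[OF _ S], rule subsetI, rule ccontr)
    fix z assume "z \<in> {z \<in> E. affine_coord (fst z) *
        (affine_coord (snd (iota1 E z)) - affine_coord (snd z))
        \<noteq> ((\<lambda>z. G (snd z)) \<circ> tau E) z - G (snd z)}" "z \<notin> S"
    then show False using xy(1,2)[of z] tau(3)[of z] by (simp add: algebra_simps)
  qed
  ultimately show ?thesis
    using b F G by (auto simp: carrier_function_field)
qed

end

section \<open>The three kernel curves\<close>

text \<open>A step \<open>(i - 1, j - 1)\<close> contributes the monomial
  \<open>u ^ i * v ^ (2 - i) * w ^ j * s ^ (2 - j)\<close>.\<close>

lemma kernel_curve_iff:
  assumes "rep_p1 p = (u, v)" "rep_p1 q = (w, s)"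
  shows "(p, q) \<in> kernel_curve {(0, 1), (1, 1), (-1, 0), (0, -1)} t \<longleftrightarrow>
      u * v * w * s - t * (u * v * w\<^sup>2 + u\<^sup>2 * w\<^sup>2 + v\<^sup>2 * w * s + u * v * s\<^sup>2) = 0"
    and "(p, q) \<in> kernel_curve {(0, 1), (1, 1), (-1, 0), (-1, -1), (0, -1)} t \<longleftrightarrow>
      u * v * w * s - t * (u * v * w\<^sup>2 + u\<^sup>2 * w\<^sup>2 + v\<^sup>2 * w * s + v\<^sup>2 * s\<^sup>2 + u * v * s\<^sup>2) = 0"
    and "(p, q) \<in> kernel_curve {(0, 1), (1, 1), (-1, 0), (1, 0), (-1, -1)} t \<longleftrightarrow>
      u * v * w * s - t * (u * v * w\<^sup>2 + u\<^sup>2 * w\<^sup>2 + v\<^sup>2 * w * s + u\<^sup>2 * w * s + v\<^sup>2 * s\<^sup>2) = 0"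
proof -
  have sum3: "sum f {..2} = f 0 + f 1 + f 2" for f :: "nat \<Rightarrow> complex"
    by (simp add: numeral_2_eq_2)
  show "(p, q) \<in> kernel_curve {(0, 1), (1, 1), (-1, 0), (0, -1)} t \<longleftrightarrow>
      u * v * w * s - t * (u * v * w\<^sup>2 + u\<^sup>2 * w\<^sup>2 + v\<^sup>2 * w * s + u * v * s\<^sup>2) = 0"
    by (simp add: kernel_curve_def assms sum3 algebra_simps)
  show "(p, q) \<in> kernel_curve {(0, 1), (1, 1), (-1, 0), (-1, -1), (0, -1)} t \<longleftrightarrow>
      u * v * w * s - t * (u * v * w\<^sup>2 + u\<^sup>2 * w\<^sup>2 + v\<^sup>2 * w * s + v\<^sup>2 * s\<^sup>2 + u * v * s\<^sup>2) = 0"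
    by (simp add: kernel_curve_def assms sum3 algebra_simps)
  show "(p, q) \<in> kernel_curve {(0, 1), (1, 1), (-1, 0), (1, 0), (-1, -1)} t \<longleftrightarrow>
      u * v * w * s - t * (u * v * w\<^sup>2 + u\<^sup>2 * w\<^sup>2 + v\<^sup>2 * w * s + u\<^sup>2 * w * s + v\<^sup>2 * s\<^sup>2) = 0"
    by (simp add: kernel_curve_def assms sum3 algebra_simps)
qed

text \<open>The equation is read as a quadratic form in either pair of coordinates. The last two
  hypotheses say that no fibre is an entire projective line.\<close>

lemma two_fibre_curveI:
  fixes a b c a' b' c' :: "complex \<Rightarrow> complex \<Rightarrow> complex"
  assumes "\<And>p q u v w s. rep_p1 p = (u, v) \<Longrightarrow> rep_p1 q = (w, s) \<Longrightarrow>
      (p, q) \<in> E \<longleftrightarrow> a u v * w\<^sup>2 + b u v * w * s + c u v * s\<^sup>2 = 0"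
    and "\<And>p q u v w s. rep_p1 p = (u, v) \<Longrightarrow> rep_p1 q = (w, s) \<Longrightarrow>
      (p, q) \<in> E \<longleftrightarrow> a' w s * u\<^sup>2 + b' w s * u * v + c' w s * v\<^sup>2 = 0"
    and "\<And>u v. (u, v) \<noteq> (0, 0) \<Longrightarrow> a u v \<noteq> 0 \<or> b u v \<noteq> 0 \<or> c u v \<noteq> 0"
    and "\<And>w s. (w, s) \<noteq> (0, 0) \<Longrightarrow> a' w s \<noteq> 0 \<or> b' w s \<noteq> 0 \<or> c' w s \<noteq> 0"
  shows "two_fibre_curve E"
proof
  fix p :: p1
  obtain u v where p: "rep_p1 p = (u, v)" by fastforce
  have "{q. (p, q) \<in> E} = {q. a u v * (fst (rep_p1 q))\<^sup>2
      + b u v * fst (rep_p1 q) * snd (rep_p1 q) + c u v * (snd (rep_p1 q))\<^sup>2 = 0}"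
    using assms(1)[OF p surjective_pairing] by simp
  moreover have "(u, v) \<noteq> (0, 0)" using rep_p1_nonzero[of p] p by simp
  ultimately show "\<exists>q\<^sub>1 q\<^sub>2. {q. (p, q) \<in> E} = {q\<^sub>1, q\<^sub>2}"
    using quadratic_form_roots[OF assms(3)] by simp
next
  fix q :: p1
  obtain w s where q: "rep_p1 q = (w, s)" by fastforce
  have "{p. (p, q) \<in> E} = {p. a' w s * (fst (rep_p1 p))\<^sup>2
      + b' w s * fst (rep_p1 p) * snd (rep_p1 p) + c' w s * (snd (rep_p1 p))\<^sup>2 = 0}"
    using assms(2)[OF surjective_pairing q] by simp
  moreover have "(w, s) \<noteq> (0, 0)" using rep_p1_nonzero[of q] q by simp
  ultimately show "\<exists>p\<^sub>1 p\<^sub>2. {p. (p, q) \<in> E} = {p\<^sub>1, p\<^sub>2}"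
    using quadratic_form_roots[OF assms(4)] by simp
qed

section \<open>Fibres and affine equations for the three step sets\<close>

context
  fixes t :: complex
  assumes t: "t \<noteq> 0" "1 + t \<noteq> 0"
begin

lemma two_fibre_curve_4:
  "two_fibre_curve (kernel_curve {(0, 1), (1, 1), (-1, 0), (0, -1)} t)"
proof (rule two_fibre_curveI)
  fix p q u v w s assume r: "rep_p1 p = (u, v)" "rep_p1 q = (w, s)"
  show "(p, q) \<in> kernel_curve {(0, 1), (1, 1), (-1, 0), (0, -1)} t \<longleftrightarrow>
      (- t * u * (u + v)) * w\<^sup>2 + (u * v - t * v\<^sup>2) * w * s + (- t * u * v) * s\<^sup>2 = 0"
    unfolding kernel_curve_iff(1)[OF r] by (simp add: algebra_simps power2_eq_square)
  show "(p, q) \<in> kernel_curve {(0, 1), (1, 1), (-1, 0), (0, -1)} t \<longleftrightarrow>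
      (- t * w\<^sup>2) * u\<^sup>2 + (w * s - t * (w\<^sup>2 + s\<^sup>2)) * u * v + (- t * w * s) * v\<^sup>2 = 0"
    unfolding kernel_curve_iff(1)[OF r] by (simp add: algebra_simps power2_eq_square)
\<comment> \<open>If the outer coefficients in \<open>w\<close>, \<open>s\<close> vanish, then
  \<open>u = 0\<close>, and the middle one is \<open>- t * v\<^sup>2\<close>. In the other direction
  \<open>w = 0\<close> leaves \<open>- t * s\<^sup>2\<close>.\<close>
qed (use t in auto)

lemma two_fibre_curve_5a:
  "two_fibre_curve (kernel_curve {(0, 1), (1, 1), (-1, 0), (-1, -1), (0, -1)} t)"
proof (rule two_fibre_curveI)
  fix p q u v w s assume r: "rep_p1 p = (u, v)" "rep_p1 q = (w, s)"
  show "(p, q) \<in> kernel_curve {(0, 1), (1, 1), (-1, 0), (-1, -1), (0, -1)} t \<longleftrightarrow>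
      (- t * u * (u + v)) * w\<^sup>2 + (u * v - t * v\<^sup>2) * w * s + (- t * v * (u + v)) * s\<^sup>2 = 0"
    unfolding kernel_curve_iff(2)[OF r] by (simp add: algebra_simps power2_eq_square)
  show "(p, q) \<in> kernel_curve {(0, 1), (1, 1), (-1, 0), (-1, -1), (0, -1)} t \<longleftrightarrow>
      (- t * w\<^sup>2) * u\<^sup>2 + (w * s - t * (w\<^sup>2 + s\<^sup>2)) * u * v + (- t * s * (w + s)) * v\<^sup>2 = 0"
    unfolding kernel_curve_iff(2)[OF r] by (simp add: algebra_simps power2_eq_square)
next
  fix u v :: complex assume "(u, v) \<noteq> (0, 0)"
  \<comment> \<open>Over \<open>x = -1\<close> both outer coefficients vanish; the middle one
    survives because \<open>1 + t \<noteq> 0\<close>. In the next lemma the same happens over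
    \<open>y = -1\<close>.\<close>
  moreover have "u * v - t * v\<^sup>2 = - (1 + t) * v\<^sup>2" if "u + v = 0"
    using that by (simp add: eq_neg_iff_add_eq_0[symmetric] algebra_simps power2_eq_square)
  ultimately show "- t * u * (u + v) \<noteq> 0 \<or> u * v - t * v\<^sup>2 \<noteq> 0 \<or> - t * v * (u + v) \<noteq> 0"
    using t by (cases "u + v = 0") auto
qed (use t in auto)

lemma two_fibre_curve_5b:
  "two_fibre_curve (kernel_curve {(0, 1), (1, 1), (-1, 0), (1, 0), (-1, -1)} t)"
proof (rule two_fibre_curveI)
  fix p q u v w s assume r: "rep_p1 p = (u, v)" "rep_p1 q = (w, s)"
  show "(p, q) \<in> kernel_curve {(0, 1), (1, 1), (-1, 0), (1, 0), (-1, -1)} t \<longleftrightarrow>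
      (- t * u * (u + v)) * w\<^sup>2 + (u * v - t * (u\<^sup>2 + v\<^sup>2)) * w * s + (- t * v\<^sup>2) * s\<^sup>2 = 0"
    unfolding kernel_curve_iff(3)[OF r] by (simp add: algebra_simps power2_eq_square)
  show "(p, q) \<in> kernel_curve {(0, 1), (1, 1), (-1, 0), (1, 0), (-1, -1)} t \<longleftrightarrow>
      (- t * w * (w + s)) * u\<^sup>2 + (w * s - t * w\<^sup>2) * u * v + (- t * s * (w + s)) * v\<^sup>2 = 0"
    unfolding kernel_curve_iff(3)[OF r] by (simp add: algebra_simps power2_eq_square)
next
  fix w s :: complex assume "(w, s) \<noteq> (0, 0)"
  moreover have "w * s - t * w\<^sup>2 = - (1 + t) * w\<^sup>2" if "w + s = 0"
    using that by (simp add: add_eq_0_iff algebra_simps power2_eq_square)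
  ultimately show "- t * w * (w + s) \<noteq> 0 \<or> w * s - t * w\<^sup>2 \<noteq> 0 \<or> - t * s * (w + s) \<noteq> 0"
    using t by (cases "w + s = 0") auto
qed (use t in auto)

lemma kernel_curve_affine:
  assumes "generic z"
  defines "x \<equiv> affine_coord (fst z)" and "y \<equiv> affine_coord (snd z)"
  shows "z \<in> kernel_curve {(0, 1), (1, 1), (-1, 0), (0, -1)} t \<Longrightarrow>
      x * y = t * (x * y\<^sup>2 + x\<^sup>2 * y\<^sup>2 + y + x)"
    and "z \<in> kernel_curve {(0, 1), (1, 1), (-1, 0), (-1, -1), (0, -1)} t \<Longrightarrow>
      x * y = t * (x * y\<^sup>2 + x\<^sup>2 * y\<^sup>2 + y + 1 + x)"
    and "z \<in> kernel_curve {(0, 1), (1, 1), (-1, 0), (1, 0), (-1, -1)} t \<Longrightarrow>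
      x * y = t * (x * y\<^sup>2 + x\<^sup>2 * y\<^sup>2 + y + x\<^sup>2 * y + 1)"
proof -
  obtain p q where z: "z = (p, q)" by fastforce
  obtain u v where p: "rep_p1 p = (u, v)" by fastforce
  obtain w s where q: "rep_p1 q = (w, s)" by fastforce
  have nz: "v \<noteq> 0" "s \<noteq> 0" using assms(1) by (simp_all add: generic_def z p q)
  have uw: "u = x * v" "w = y * s"
    using nz by (simp_all add: x_def y_def z p q affine_coord_def)
  \<comment> \<open>After substituting \<open>u = x * v\<close> and \<open>w = y * s\<close>, the
    form of bidegree (2, 2) carries the common factor \<open>v\<^sup>2 * s\<^sup>2\<close>.\<close>
  have scale: "k = l" if "k * (v\<^sup>2 * s\<^sup>2) - l * (v\<^sup>2 * s\<^sup>2) = 0" for k l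
    using that nz by simp
  show "x * y = t * (x * y\<^sup>2 + x\<^sup>2 * y\<^sup>2 + y + x)"
    if "z \<in> kernel_curve {(0, 1), (1, 1), (-1, 0), (0, -1)} t"
    using that unfolding z kernel_curve_iff(1)[OF p q] uw
    by - (rule scale, simp add: algebra_simps power2_eq_square)
  show "x * y = t * (x * y\<^sup>2 + x\<^sup>2 * y\<^sup>2 + y + 1 + x)"
    if "z \<in> kernel_curve {(0, 1), (1, 1), (-1, 0), (-1, -1), (0, -1)} t"
    using that unfolding z kernel_curve_iff(2)[OF p q] uw
    by - (rule scale, simp add: algebra_simps power2_eq_square)
  show "x * y = t * (x * y\<^sup>2 + x\<^sup>2 * y\<^sup>2 + y + x\<^sup>2 * y + 1)"
    if "z \<in> kernel_curve {(0, 1), (1, 1), (-1, 0), (1, 0), (-1, -1)} t"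
    using that unfolding z kernel_curve_iff(3)[OF p q] uw
    by - (rule scale, simp add: algebra_simps power2_eq_square)
qed

text \<open>Divided by \<open>t * x * y\<close>, the curve equation reads
  \<open>1 / t = y + x * y + 1 / x + 1 / y\<close>, whose only mixed term is
  \<open>x * y\<close>.\<close>

lemma decoupled_4:
  assumes "x * y = t * (x * y\<^sup>2 + x\<^sup>2 * y\<^sup>2 + y + x)" "x \<noteq> 0" "y \<noteq> 0"
  shows "x * y = - 1 / x + (- 1 - y\<^sup>2) / y + 1 / t"
proof -
  have "(x * y - (- 1 / x + (- 1 - y\<^sup>2) / y + 1 / t)) * (t * x * y)
      = t * (x * y\<^sup>2 + x\<^sup>2 * y\<^sup>2 + y + x) - x * y"
    using assms(2,3) t by (simp add: field_simps power2_eq_square)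
  also have "\<dots> = 0" using assms(1) by simp
  finally show ?thesis using assms(2,3) t by simp
qed

text \<open>
  Modulo the equation of the curve, \<open>(1 + x) (y + 1 / (x y)) = 1 / t - 1 / x\<close>; this turns the mixed
  term \<open>1 / (x y)\<close> into a function of \<open>x\<close> minus \<open>y\<close>. In \<open>decoupled_5b\<close> it becomes likewise a
  function of \<open>y\<close> minus \<open>x\<close>, by \<open>(1 + y) (x + 1 / (x y)) = 1 / t - y\<close>.
\<close>

lemma decoupled_5a:
  assumes "x * y = t * (x * y\<^sup>2 + x\<^sup>2 * y\<^sup>2 + y + 1 + x)" "1 + x \<noteq> 0" "y \<noteq> 0"
  shows "x * y = - (1 + 1 / t) / (1 + x) + - 1 / y + 1 / t"
proof -
  \<comment> \<open>The poles at \<open>x = 0\<close> cancel by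
    \<open>- 1 / x + 1 / (x * (1 + x)) = - 1 / (1 + x)\<close>, which explains the numerator
    \<open>- (1 + 1 / t)\<close>. Clearing denominators turns the difference of the two sides into
    the curve equation.\<close>
  have "(x * y - (- (1 + 1 / t) / (1 + x) + - 1 / y + 1 / t)) * (t * (1 + x) * y)
      = t * (x * y\<^sup>2 + x\<^sup>2 * y\<^sup>2 + y + 1 + x) - x * y"
    using assms(2,3) t by (simp add: divide_simps) (simp add: algebra_simps power2_eq_square)
  also have "\<dots> = 0" using assms(1) by simp
  finally show ?thesis using assms(2,3) t by simp
qed

lemma decoupled_5b:
  assumes "x * y = t * (x * y\<^sup>2 + x\<^sup>2 * y\<^sup>2 + y + x\<^sup>2 * y + 1)" "x \<noteq> 0" "1 + y \<noteq> 0"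
  shows "x * y = - 1 / x + (- (1 / t) - y\<^sup>2) / (1 + y) + 1 / t"
proof -
  \<comment> \<open>The term \<open>- y\<^sup>2\<close> in the numerator comes from
    \<open>- y + y / (1 + y) = - y\<^sup>2 / (1 + y)\<close>.\<close>
  have "(x * y - (- 1 / x + (- (1 / t) - y\<^sup>2) / (1 + y) + 1 / t)) * (t * x * (1 + y))
      = t * (x * y\<^sup>2 + x\<^sup>2 * y\<^sup>2 + y + x\<^sup>2 * y + 1) - x * y"
    using assms(2,3) t by (simp add: divide_simps) (simp add: algebra_simps power2_eq_square)
  also have "\<dots> = 0" using assms(1) by simp
  finally show ?thesis using assms(2,3) t by simp
qed

lemma two_fibre_curve_kernel_curve:
  assumes "\<D> \<in> {{(0, 1), (1, 1), (-1, 0), (0, -1)},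
                      {(0, 1), (1, 1), (-1, 0), (-1, -1), (0, -1)},
                      {(0, 1), (1, 1), (-1, 0), (1, 0), (-1, -1)}}"
  shows "two_fibre_curve (kernel_curve \<D> t)"
  using assms two_fibre_curve_4 two_fibre_curve_5a two_fibre_curve_5b by auto

lemma tau_coboundary_kernel_curve:
  assumes "\<D> \<in> {{(0, 1), (1, 1), (-1, 0), (0, -1)},
                      {(0, 1), (1, 1), (-1, 0), (-1, -1), (0, -1)},
                      {(0, 1), (1, 1), (-1, 0), (1, 0), (-1, -1)}}"
    and E: "E = kernel_curve \<D> t" and b: "b \<in> {b1 E, b2 E}"
  shows "\<exists>g\<in>carrier (function_field E). b = pullback E (tau E) g \<ominus>\<^bsub>function_field E\<^esub> g"
proof -
  interpret two_fibre_curve E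
    unfolding E by (rule two_fibre_curve_kernel_curve[OF assms(1)])
  \<comment> \<open>It suffices to decouple at generic points, and the additive constant is
    \<open>1 / t\<close> for all three step sets.\<close>
  have coboundary: ?thesis
    if nz: "Q \<noteq> 0" "Q' \<noteq> 0"
      and eq: "\<And>z. z \<in> E \<Longrightarrow> generic z \<Longrightarrow> affine_coord (fst z) * affine_coord (snd z)
        = rational_coord P Q (fst z) + rational_coord P' Q' (snd z) + 1 / t"
    for P Q P' Q'
  proof -
    have "finite {z \<in> E. affine_coord (fst z) * affine_coord (snd z)
        \<noteq> rational_coord P Q (fst z) + rational_coord P' Q' (snd z) + 1 / t}"
      by (rule finite_subset[OF _ finite_not_generic]) (use eq in blast)
    then show ?thesis
      by (rule tau_coboundary_if_decoupled[OF rational_coord_fst rational_coord_snd _ b, OF nz])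
  qed
  have nz: "affine_coord (fst z) \<noteq> 0" "1 + affine_coord (fst z) \<noteq> 0"
      "affine_coord (snd z) \<noteq> 0" "1 + affine_coord (snd z) \<noteq> 0" if "generic z" for z
    using that by (auto simp: generic_def add_eq_0_iff)
  from assms(1) show ?thesis
    unfolding insert_iff empty_iff
  proof (elim disjE FalseE)
    assume \<D>: "\<D> = {(0, 1), (1, 1), (-1, 0), (0, -1)}"
    show ?thesis
    \<comment> \<open>The first two polynomials are the denominators of \<open>F\<close> and
      \<open>G\<close>, the last two their numerators; the other cases use the same order.\<close>
    proof (rule coboundary[of "[:0, 1:]" "[:0, 1:]" "[:- 1:]" "[:- 1, 0, - 1:]"])
      fix z assume z: "z \<in> E" "generic z"
      note decoupled_4[OF kernel_curve_affine(1)[OF z(2) z(1)[unfolded E \<D>]]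
          nz(1)[OF z(2)] nz(3)[OF z(2)]]
      then show "affine_coord (fst z) * affine_coord (snd z)
          = rational_coord [:- 1:] [:0, 1:] (fst z) + rational_coord [:- 1, 0, - 1:] [:0, 1:] (snd z) + 1 / t"
        by (simp add: rational_coord_def power2_eq_square)
    qed simp_all
  next
    assume \<D>: "\<D> = {(0, 1), (1, 1), (-1, 0), (-1, -1), (0, -1)}"
    show ?thesis
    proof (rule coboundary[of "[:1, 1:]" "[:0, 1:]" "[:- (1 + 1 / t):]" "[:- 1:]"])
      fix z assume z: "z \<in> E" "generic z"
      note decoupled_5a[OF kernel_curve_affine(2)[OF z(2) z(1)[unfolded E \<D>]]
          nz(2)[OF z(2)] nz(3)[OF z(2)]]
      then show "affine_coord (fst z) * affine_coord (snd z)
          = rational_coord [:- (1 + 1 / t):] [:1, 1:] (fst z) + rational_coord [:- 1:] [:0, 1:] (snd z) + 1 / t"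
        by (simp add: rational_coord_def power2_eq_square)
    qed simp_all
  next
    assume \<D>: "\<D> = {(0, 1), (1, 1), (-1, 0), (1, 0), (-1, -1)}"
    show ?thesis
    proof (rule coboundary[of "[:0, 1:]" "[:1, 1:]" "[:- 1:]" "[:- (1 / t), 0, - 1:]"])
      fix z assume z: "z \<in> E" "generic z"
      note decoupled_5b[OF kernel_curve_affine(3)[OF z(2) z(1)[unfolded E \<D>]]
          nz(1)[OF z(2)] nz(4)[OF z(2)]]
      then show "affine_coord (fst z) * affine_coord (snd z)
          = rational_coord [:- 1:] [:0, 1:] (fst z) + rational_coord [:- (1 / t), 0, - 1:] [:1, 1:] (snd z) + 1 / t"
        by (simp add: rational_coord_def power2_eq_square)
    qed simp_all
  qed
qed

end

section \<open>The telescoping equation, solved with order zero\<close>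

theorem theorem6p5:
  fixes \<D> :: "(int \<times> int) set" and t :: real and E :: "pt set"
    and \<Omega> :: differential and \<delta> :: "(pt \<Rightarrow> complex) set \<Rightarrow> (pt \<Rightarrow> complex) set"
  assumes steps: "\<D> \<in> {{(0, 1), (1, 1), (-1, 0), (0, -1)},
                      {(0, 1), (1, 1), (-1, 0), (-1, -1), (0, -1)},
                      {(0, 1), (1, 1), (-1, 0), (1, 0), (-1, -1)}}"
    and t_range: "0 < t" "t < 1 / real (card \<D>)"
    and t_transcendental: "\<not> algebraic t"
    and E: "E = kernel_curve \<D> (complex_of_real t)"
    and infinite_group: "infinite (walk_group E)"
    and \<Omega>: "\<Omega> \<in> regular_differentials E" "\<Omega> \<noteq> zero_diff E"
    and \<delta>: "\<delta> \<in> derivations E"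
      "\<forall>f\<in>carrier (function_field E). exterior_d E f = smult_diff E (\<delta> f) \<Omega>"
  shows "\<forall>b\<in>{b1 E, b2 E}. \<exists>(n::nat) (c :: nat \<Rightarrow> complex). \<exists>g\<in>carrier (function_field E).
      (\<delta> ^^ n) b \<oplus>\<^bsub>function_field E\<^esub>
        (\<Oplus>\<^bsub>function_field E\<^esub>k\<in>{..<n}. const_fun E (c k) \<otimes>\<^bsub>function_field E\<^esub> (\<delta> ^^ k) b)
      = pullback E (tau E) g \<ominus>\<^bsub>function_field E\<^esub> g"
proof (intro ballI exI)
  fix b assume b: "b \<in> {b1 E, b2 E}"
  have t: "complex_of_real t \<noteq> 0" "1 + complex_of_real t \<noteq> 0"
    using t_range(1) by (simp_all add: complex_eq_iff)
  interpret two_fibre_curve E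
    unfolding E by (rule two_fibre_curve_kernel_curve[OF t steps])
  obtain g where g: "g \<in> carrier (function_field E)"
      "b = pullback E (tau E) g \<ominus>\<^bsub>function_field E\<^esub> g"
    using tau_coboundary_kernel_curve[OF t steps E b] by blast
  \<comment> \<open>With \<open>n = 0\<close> the sum is empty and the left-hand side is
    \<open>b\<close> itself; the coefficients are set to the arbitrary value 0.\<close>
  show "\<exists>g\<in>carrier (function_field E).
      (\<delta> ^^ 0) b \<oplus>\<^bsub>function_field E\<^esub>
        (\<Oplus>\<^bsub>function_field E\<^esub>k\<in>{..<0}. const_fun E ((\<lambda>_. 0) k) \<otimes>\<^bsub>function_field E\<^esub> (\<delta> ^^ k) b)
      = pullback E (tau E) g \<ominus>\<^bsub>function_field E\<^esub> g"
  proof (rule bexI[OF _ g(1)])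
    \<comment> \<open>Evaluating the empty sum as a fold requires its starting value to lie in the
      carrier; here zero is represented by the quotient \<open>0 / 1\<close>.\<close>
    have zero: "\<zero>\<^bsub>function_field E\<^esub> \<in> carrier (function_field E)"
      using rational_coord_fst[of 1 0]
      by (simp add: function_field_zero carrier_function_field rational_coord_def)
    have "b \<oplus>\<^bsub>function_field E\<^esub> \<zero>\<^bsub>function_field E\<^esub> = b"
      using b by (auto simp: b1_eq b2_eq function_field_zero function_field_add)
    then show "(\<delta> ^^ 0) b \<oplus>\<^bsub>function_field E\<^esub>
        (\<Oplus>\<^bsub>function_field E\<^esub>k\<in>{..<0}. const_fun E ((\<lambda>_. 0) k) \<otimes>\<^bsub>function_field E\<^esub> (\<delta> ^^ k) b)
      = pullback E (tau E) g \<ominus>\<^bsub>function_field E\<^esub> g"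
      using zero by (simp add: g(2) finsum_def finprod_def)
  qed
qed

end
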